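(* Let $X$ be a Banach space. Suppose there exist $\delta>0$ and $z\in S_X$ such that $X$ star-denies the Daugavet property with the set $S(B_{X^*},z,\delta)\cap S_{X^*}$. Then $X$ is not a Daugavet range.
   Context: All Banach spaces are real and different from $\{0\}$. A nonzero continuous linear operator $G:X\to Y$ between Banach spaces is a Daugavet center if every (bounded) rank-1 operator $T:X\to Y$ satisfies $\|G+T\|=\|G\|+\|T\|$. A Banach space $X$ is a Daugavet range if there exist a Banach space $E$ and a Daugavet center $G:E\to X$. $B_X$ and $S_X$ are the closed unit ball and unit sphere of $X$. For $z\in S_X$ and $\varepsilon>0$, $S(B_{X^*},z,\varepsilon)=\{x^*\in B_{X^*}: x^*(z)>1-\varepsilon\}$. For $x^*\in X^*$, $y\in X$, $x^*\otimes y$ is the operator $x\mapsto x^*(x)y$. $X$ star-denies the Daugavet property with a set $A\subset S_{X^*}$ if there is an $\varepsilon>0$ such that for every $x^*\in A$ there exists a $y\in S_X$ satisfying $\|\mathrm{Id}+x^*\otimes y\|<2-\varepsilon$. *)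

theory Defs
  imports "HOL-Analysis.Analysis"
begin

text \<open>The dual of a real Banach space \<open>'a\<close> is \<open>'a \<Rightarrow>\<^sub>L real\<close> with the operator norm.\<close>

lift_definition rank_one_op ::
  "('a::real_normed_vector \<Rightarrow>\<^sub>L real) \<Rightarrow> 'b::real_normed_vector \<Rightarrow> 'a \<Rightarrow>\<^sub>L 'b"
  (infixr \<open>\<otimes>\<^sub>L\<close> 75) is "\<lambda>f y x. f x *\<^sub>R y"
  by (rule bounded_linear_scaleR_const)

text \<open>\<open>dim V = 1\<close> says that \<open>V\<close> is spanned by a single nonzero vector, also inside an
  infinite-dimensional space (\<open>dim\<close> is 0 on infinite-dimensional subspaces).\<close>

definition rank_one :: "('a::real_normed_vector \<Rightarrow>\<^sub>L 'b::real_normed_vector) \<Rightarrow> bool" where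
  "rank_one T \<longleftrightarrow> dim (range (blinfun_apply T)) = 1"

definition daugavet_center :: "('a::banach \<Rightarrow>\<^sub>L 'b::banach) \<Rightarrow> bool" where
  "daugavet_center G \<longleftrightarrow>
     G \<noteq> 0 \<and> (\<forall>T :: 'a \<Rightarrow>\<^sub>L 'b. rank_one T \<longrightarrow> norm (G + T) = norm G + norm T)"

text \<open>HOL has no quantifier over types, so the Banach space \<open>E\<close> in ``there exist a Banach space
  \<open>E\<close> and a Daugavet center \<open>G : E \<rightarrow> X\<close>'' is a parameter: \<open>X\<close> is a Daugavet range iff
  \<open>daugavet_range_from TYPE('e) TYPE('x)\<close> holds for some Banach space \<open>'e\<close>.  Hence \<open>X\<close> is not a
  Daugavet range iff the negation holds for arbitrary \<open>'e\<close>, i.e. with \<open>'e\<close> a type variable of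
  the theorem.  A Daugavet center is nonzero, so \<open>'e\<close> and \<open>'x\<close> are then different from \<open>{0}\<close>.\<close>

definition daugavet_range_from :: "'e::banach itself \<Rightarrow> 'x::banach itself \<Rightarrow> bool" where
  "daugavet_range_from E X \<longleftrightarrow> (\<exists>G :: 'e \<Rightarrow>\<^sub>L 'x. daugavet_center G)"

definition dual_ball_slice :: "'x::real_normed_vector \<Rightarrow> real \<Rightarrow> ('x \<Rightarrow>\<^sub>L real) set" where
  "dual_ball_slice z \<epsilon> = {f \<in> cball 0 1. blinfun_apply f z > 1 - \<epsilon>}"

definition star_denies_daugavet :: "('x::banach \<Rightarrow>\<^sub>L real) set \<Rightarrow> bool" where
  "star_denies_daugavet A \<longleftrightarrow>
     A \<subseteq> sphere 0 1 \<and>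
     (\<exists>\<epsilon>>0. \<forall>f\<in>A. \<exists>y\<in>sphere 0 1. norm (id_blinfun + f \<otimes>\<^sub>L y) < 2 - \<epsilon>)"

end

theory Submission
  imports Defs
begin

text \<open>For a norm-one functional \<open>f\<close> and \<open>y \<in> S\<^sub>X\<close> with \<open>\<parallel>Id + f \<otimes> y\<parallel> < 2 - \<epsilon>\<close>, composing with a
  Daugavet center \<open>G\<close> gives \<open>\<parallel>G\<parallel> + \<parallel>f \<circ> G\<parallel> = \<parallel>G + (f \<circ> G) \<otimes> y\<parallel> \<le> (2 - \<epsilon>)\<parallel>G\<parallel>\<close>, so
  \<open>\<parallel>f \<circ> G\<parallel> \<le> (1 - \<epsilon>)\<parallel>G\<parallel>\<close>.  On the other hand \<open>\<parallel>G + g \<otimes> z\<parallel> = 2\<parallel>G\<parallel>\<close> for any \<open>g\<close> of norm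
  \<open>\<parallel>G\<parallel>\<close>, and a functional norming the image of a suitable unit vector under \<open>G + g \<otimes> z\<close> is, up to
  sign, in any given slice at \<open>z\<close> and has \<open>\<parallel>f \<circ> G\<parallel>\<close> as close to \<open>\<parallel>G\<parallel>\<close> as desired.  Norming
  functionals come from the Hahn--Banach theorem, obtained here from minimal sublinear
  functionals.\<close>

section \<open>Sublinear functionals and the Hahn-Banach theorem\<close>

definition sublinear :: "('a::real_vector \<Rightarrow> real) \<Rightarrow> bool" where
  "sublinear p \<longleftrightarrow> (\<forall>x y. p (x + y) \<le> p x + p y) \<and> (\<forall>c\<ge>0. \<forall>x. p (c *\<^sub>R x) = c * p x)"

text \<open>Applying the scaling inequality with factor \<open>1 / c\<close> to
  \<open>c *\<^sub>R x\<close> gives the reverse inequality.\<close>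

lemma sublinearI:
  assumes "\<And>x y. p (x + y) \<le> p x + p y" and "\<And>c x. c > 0 \<Longrightarrow> p (c *\<^sub>R x) \<le> c * p x"
    and "p 0 = 0"
  shows "sublinear p"
proof -
  have "p (c *\<^sub>R x) = c * p x" if "c \<ge> 0" for c x
  proof (cases "c = 0")
    case False
    then have c: "c > 0" using that by simp
    have "p x = p ((1 / c) *\<^sub>R (c *\<^sub>R x))" using c by simp
    also have "\<dots> \<le> (1 / c) * p (c *\<^sub>R x)" using c by (intro assms(2)) simp
    finally have "c * p x \<le> p (c *\<^sub>R x)" using c by (simp add: field_simps)
    then show ?thesis using assms(2)[OF c, of x] by simp
  qed (simp add: assms)
  then show ?thesis using assms(1) by (simp add: sublinear_def)
qed

lemma sublinear_add: "sublinear p \<Longrightarrow> p (x + y) \<le> p x + p y"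
  by (simp add: sublinear_def)

lemma sublinear_scale: "sublinear p \<Longrightarrow> c \<ge> 0 \<Longrightarrow> p (c *\<^sub>R x) = c * p x"
  by (simp add: sublinear_def)

lemma sublinear_zero: "sublinear p \<Longrightarrow> p 0 = 0"
  using sublinear_scale[of p 0 0] by simp

lemma sublinear_minus: "sublinear p \<Longrightarrow> - p (- x) \<le> p x"
  using sublinear_add[of p x "- x"] sublinear_zero[of p] by simp

lemma sublinear_norm: "sublinear norm"
  by (simp add: sublinear_def norm_triangle_ineq)

text \<open>Take the infimum over \<open>t \<ge> 0\<close> of
  \<open>p (x + t *\<^sub>R v) - t * p v\<close>: \<open>t = 0\<close> gives
  \<open>q \<le> p\<close>, and \<open>t = 1\<close> at \<open>- v\<close> gives the last bound. A
  minimal \<open>p\<close> therefore satisfies \<open>p (- v) \<le> - p v\<close>.\<close>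

lemma sublinear_improve:
  assumes p: "sublinear p"
  obtains q where "sublinear q" "q \<le> p" "q (- v) \<le> - p v"
proof -
  define q where "q = (\<lambda>x. INF t\<in>{0..}. p (x + t *\<^sub>R v) - t * p v)"
  \<comment> \<open>The infimum is finite because \<open>t * p v = p (t *\<^sub>R v) \<le> p (x + t
    *\<^sub>R v) + p (- x)\<close>.\<close>
  have lower: "- p (- x) \<le> p (x + t *\<^sub>R v) - t * p v" if "t \<ge> 0" for x t
    using sublinear_add[OF p, of "x + t *\<^sub>R v" "- x"] sublinear_scale[OF p that, of v] by simp
  have bdd: "bdd_below ((\<lambda>t. p (x + t *\<^sub>R v) - t * p v) ` {0..})" for x
    by (rule bdd_belowI2[where m = "- p (- x)"]) (simp add: lower)
  have q_le: "q x \<le> p (x + t *\<^sub>R v) - t * p v" if "t \<ge> 0" for x t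
    unfolding q_def by (rule cINF_lower[OF bdd]) (use that in simp)
  have q_ge: "m \<le> q x" if "\<And>t. t \<ge> 0 \<Longrightarrow> m \<le> p (x + t *\<^sub>R v) - t * p v" for m x
    unfolding q_def by (rule cINF_greatest) (use that in auto)
  have add: "q (x + y) \<le> q x + q y" for x y
  proof -
    \<comment> \<open>Parameters \<open>t\<close> for \<open>x\<close> and \<open>s\<close> for
      \<open>y\<close> combine to \<open>t + s\<close> for \<open>x + y\<close>; the infimum is
      taken first over \<open>t\<close>, then over \<open>s\<close>.\<close>
    have "q (x + y) - (p (y + s *\<^sub>R v) - s * p v) \<le> q x" if s: "s \<ge> 0" for s
    proof (rule q_ge)
      fix t :: real assume t: "t \<ge> 0"
      have "q (x + y) \<le> p ((x + t *\<^sub>R v) + (y + s *\<^sub>R v)) - (t + s) * p v"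
        using q_le[of "t + s" "x + y"] s t by (simp add: algebra_simps)
      also have "\<dots> \<le> p (x + t *\<^sub>R v) + p (y + s *\<^sub>R v) - (t + s) * p v"
        using sublinear_add[OF p] by simp
      finally show "q (x + y) - (p (y + s *\<^sub>R v) - s * p v) \<le> p (x + t *\<^sub>R v) - t * p v"
        by (simp add: algebra_simps)
    qed
    then have "q (x + y) - q x \<le> q y" by (intro q_ge) (simp add: algebra_simps)
    then show ?thesis by simp
  qed
  have scale: "q (c *\<^sub>R x) \<le> c * q x" if c: "c > 0" for c x
  proof -
    have "q (c *\<^sub>R x) / c \<le> q x"
    proof (rule q_ge)
      fix t :: real assume t: "t \<ge> 0"
      have "q (c *\<^sub>R x) \<le> p (c *\<^sub>R (x + t *\<^sub>R v)) - (c * t) * p v"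
        using q_le[of "c * t" "c *\<^sub>R x"] c t by (simp add: scaleR_add_right)
      also have "\<dots> = c * (p (x + t *\<^sub>R v) - t * p v)"
        using c sublinear_scale[OF p, of c "x + t *\<^sub>R v"] by (simp add: right_diff_distrib)
      finally show "q (c *\<^sub>R x) / c \<le> p (x + t *\<^sub>R v) - t * p v"
        using c by (simp add: field_simps)
    qed
    then show ?thesis using c by (simp add: field_simps)
  qed
  have zero: "q 0 = 0"
  proof (rule antisym)
    show "q 0 \<le> 0" using q_le[of 0 0] by (simp add: sublinear_zero[OF p])
    show "0 \<le> q 0" by (rule q_ge) (simp add: sublinear_scale[OF p])
  qed
  show ?thesis
  proof
    show "sublinear q" using add scale zero by (rule sublinearI)
    show "q \<le> p" using q_le[of 0] by (simp add: le_fun_def)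
    show "q (- v) \<le> - p v" using q_le[of 1 "- v"] by (simp add: sublinear_zero[OF p])
  qed
qed

text \<open>The pointwise infimum works: it is finite since every member lies above
  \<open>- p (- x)\<close>, and subadditivity uses the chain to replace two members by the smaller
  one.\<close>

lemma sublinear_INF_chain:
  assumes sub: "\<And>q. q \<in> C \<Longrightarrow> sublinear q" and le: "\<And>q. q \<in> C \<Longrightarrow> q \<le> p"
    and ne: "C \<noteq> {}" and chain: "\<And>q r. q \<in> C \<Longrightarrow> r \<in> C \<Longrightarrow> q \<le> r \<or> r \<le> q"
  obtains q where "sublinear q" "\<And>r. r \<in> C \<Longrightarrow> q \<le> r"
proof -
  define q where "q = (\<lambda>x. INF r\<in>C. r x)"
  have lower: "- p (- x) \<le> r x" if "r \<in> C" for r x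
    using sublinear_minus[OF sub[OF that], of x] le[OF that]
    by (meson le_funD neg_le_iff_le order_trans)
  have bdd: "bdd_below ((\<lambda>r. r x) ` C)" for x
    by (rule bdd_belowI2[where m = "- p (- x)"]) (rule lower)
  have q_le: "q x \<le> r x" if "r \<in> C" for r x
    unfolding q_def by (rule cINF_lower[OF bdd that])
  have q_ge: "m \<le> q x" if "\<And>r. r \<in> C \<Longrightarrow> m \<le> r x" for m x
    unfolding q_def by (rule cINF_greatest[OF ne that])
  have add: "q (x + y) \<le> q x + q y" for x y
  proof -
    have "q (x + y) - s y \<le> q x" if s: "s \<in> C" for s
    proof (rule q_ge)
      fix r assume r: "r \<in> C"
      obtain u where u: "u \<in> C" "u \<le> r" "u \<le> s" using chain[OF r s] r s by auto
      have "q (x + y) \<le> u x + u y"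
        using q_le[OF u(1), of "x + y"] sublinear_add[OF sub[OF u(1)], of x y] by simp
      also have "\<dots> \<le> r x + s y" using u by (intro add_mono) (auto simp: le_fun_def)
      finally show "q (x + y) - s y \<le> r x" by simp
    qed
    then have "q (x + y) - q x \<le> q y" by (intro q_ge) (simp add: algebra_simps)
    then show ?thesis by simp
  qed
  have scale: "q (c *\<^sub>R x) \<le> c * q x" if c: "c > 0" for c x
  proof -
    have "q (c *\<^sub>R x) / c \<le> q x"
    proof (rule q_ge)
      fix r assume r: "r \<in> C"
      show "q (c *\<^sub>R x) / c \<le> r x"
        using q_le[OF r, of "c *\<^sub>R x"] c by (simp add: sublinear_scale[OF sub[OF r]] field_simps)
    qed
    then show ?thesis using c by (simp add: field_simps)
  qed
  have zero: "q 0 = 0"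
    using ne by (simp add: q_def sublinear_zero[OF sub] cong: image_cong)
  show ?thesis
    by (rule that[OF sublinearI[OF add scale zero]]) (simp_all add: le_fun_def q_le)
qed

text \<open>Zorn's lemma yields a minimal sublinear functional below \<open>p\<close>. Minimality
  makes it odd, and an odd sublinear functional is linear: its inequalities at negated arguments are
  the reverse ones.\<close>

lemma sublinear_dominates_linear:
  fixes p :: "'a::real_vector \<Rightarrow> real"
  assumes p: "sublinear p"
  obtains f where "linear f" "f \<le> p"
proof -
  let ?A = "{q. sublinear q \<and> q \<le> p}"
  \<comment> \<open>The order is reversed, so that a maximal element in Zorn's lemma is a minimal
    functional.\<close>
  have po: "partial_order_on ?A (relation_of (\<ge>) ?A)"
    by (rule partial_order_on_relation_ofI) auto
  have "\<exists>m\<in>?A. \<forall>q\<in>?A. q \<le> m \<longrightarrow> q = m"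
  proof (rule predicate_Zorn[OF po])
    fix C assume C: "C \<in> Chains (relation_of (\<ge>) ?A)"
    then have CA: "q \<in> ?A" if "q \<in> C" for q
      using that Chains_relation_of[OF C] by blast
    have chain: "q \<le> r \<or> r \<le> q" if "q \<in> C" "r \<in> C" for q r
      using C that by (auto simp: Chains_def relation_of_def)
    show "\<exists>u\<in>?A. \<forall>q\<in>C. q \<ge> u"
    proof (cases "C = {}")
      case True
      then show ?thesis using p by auto
    next
      case False
      obtain u where u: "sublinear u" "\<And>r. r \<in> C \<Longrightarrow> u \<le> r"
        using sublinear_INF_chain[of C p] CA False chain by blast
      with False CA have "u \<le> p" using order_trans by blast
      with u show ?thesis by auto
    qed
  qed
  then obtain m where m: "sublinear m" "m \<le> p"
    and minimal: "\<And>q. sublinear q \<Longrightarrow> q \<le> m \<Longrightarrow> q = m"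
    by (auto intro: order_trans)
  have neg: "m (- x) = - m x" for x
  proof -
    obtain q where "sublinear q" "q \<le> m" "q (- x) \<le> - m x"
      using sublinear_improve[OF m(1)] by blast
    with minimal have "m (- x) \<le> - m x" by blast
    then show ?thesis using sublinear_minus[OF m(1), of x] by simp
  qed
  have "linear m"
  proof (rule linearI)
    fix x y
    show "m (x + y) = m x + m y"
      using sublinear_add[OF m(1), of x y] sublinear_add[OF m(1), of "- x" "- y"]
        neg[of "x + y"] by (simp add: neg)
  next
    fix c x
    show "m (c *\<^sub>R x) = c *\<^sub>R m x"
      using sublinear_scale[OF m(1), of c x] sublinear_scale[OF m(1), of "- c" x]
        neg[of "c *\<^sub>R x"] by (cases "c \<ge> 0") simp_all
  qed
  then show ?thesis using m(2) by (rule that)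
qed

text \<open>Improving the norm in direction \<open>v\<close> before passing to a linear
  \<open>h\<close> forces \<open>h (- v) \<le> - norm v\<close>, hence equality at
  \<open>v\<close>.\<close>

lemma norming_functional:
  fixes v :: "'a::real_normed_vector"
  assumes "v \<noteq> 0"
  obtains f :: "'a \<Rightarrow>\<^sub>L real" where "norm f = 1" "f v = norm v"
proof -
  obtain q :: "'a \<Rightarrow> real" where q: "sublinear q" "q \<le> norm" "q (- v) \<le> - norm v"
    using sublinear_improve[OF sublinear_norm] by blast
  obtain h where h: "linear h" "h \<le> q" using sublinear_dominates_linear[OF q(1)] .
  have h_le: "h x \<le> norm x" for x
    using h(2) q(2) by (meson le_funD order_trans)
  have h_abs: "\<bar>h x\<bar> \<le> norm x" for x
    using h_le[of x] h_le[of "- x"] linear_neg[OF h(1), of x] by simp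
  have "bounded_linear h"
    by (rule bounded_linear_intro[where K = 1])
      (use h_abs linear_add[OF h(1)] linear_cmul[OF h(1)] in simp_all)
  then have F: "blinfun_apply (Blinfun h) = h" by (rule bounded_linear_Blinfun_apply)
  have "h (- v) \<le> - norm v" using le_funD[OF h(2), of "- v"] q(3) by simp
  then have hv: "h v = norm v"
    using h_le[of v] linear_neg[OF h(1), of v] by simp
  have "norm (Blinfun h) \<le> 1" by (rule norm_blinfun_bound) (simp_all add: F h_abs)
  moreover have "norm v \<le> norm (Blinfun h) * norm v"
    using norm_blinfun[of "Blinfun h" v] by (simp add: F hv)
  then have "1 \<le> norm (Blinfun h)" using assms by simp
  ultimately show ?thesis using that[of "Blinfun h"] by (simp add: F hv)
qed

section \<open>Rank-one operators\<close>

lemma norm_rank_one_op: "norm (f \<otimes>\<^sub>L y) = norm f * norm y"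
proof (cases "y = 0")
  case True
  then have "f \<otimes>\<^sub>L y = 0" by (intro blinfun_eqI) (simp add: rank_one_op.rep_eq)
  with True show ?thesis by simp
next
  case False
  show ?thesis
  proof (rule antisym)
    show "norm (f \<otimes>\<^sub>L y) \<le> norm f * norm y"
    proof (rule norm_blinfun_bound)
      fix x
      show "norm ((f \<otimes>\<^sub>L y) x) \<le> norm f * norm y * norm x"
        using mult_right_mono[OF norm_blinfun[of f x], of "norm y"]
        by (simp add: rank_one_op.rep_eq mult_ac)
    qed simp
    have "norm f \<le> norm (f \<otimes>\<^sub>L y) / norm y"
    proof (rule norm_blinfun_bound)
      fix x
      show "norm (f x) \<le> norm (f \<otimes>\<^sub>L y) / norm y * norm x"
        using norm_blinfun[of "f \<otimes>\<^sub>L y" x] False by (simp add: rank_one_op.rep_eq field_simps)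
    qed simp
    then show "norm f * norm y \<le> norm (f \<otimes>\<^sub>L y)" using False by (simp add: field_simps)
  qed
qed

lemma rank_one_rank_one_op:
  assumes "f \<noteq> 0" "y \<noteq> 0"
  shows "rank_one (f \<otimes>\<^sub>L y)"
proof -
  obtain x where x: "f x \<noteq> 0" using assms(1) blinfun_eqI[of f 0] by auto
  have "range (f \<otimes>\<^sub>L y) = span {y}"
  proof
    show "span {y} \<subseteq> range (f \<otimes>\<^sub>L y)"
    proof
      fix w assume "w \<in> span {y}"
      then obtain k where "w = k *\<^sub>R y" by (auto simp: span_singleton)
      then have "w = (f \<otimes>\<^sub>L y) ((k / f x) *\<^sub>R x)"
        using x by (simp add: rank_one_op.rep_eq blinfun.scaleR_right)
      then show "w \<in> range (f \<otimes>\<^sub>L y)" by blast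
    qed
  qed (auto simp: rank_one_op.rep_eq span_singleton)
  then show ?thesis
    using assms(2) dim_eq_card_independent[of "{y}"] by (simp add: rank_one_def)
qed

section \<open>Daugavet centers and functionals on the range\<close>

lemma daugavet_center_norm_add:
  assumes "daugavet_center G" "norm y = 1"
  shows "norm (G + f \<otimes>\<^sub>L y) = norm G + norm f"
proof (cases "f = 0")
  \<comment> \<open>The zero operator is not of rank one, so the definition does not cover this
    case; it can arise later as \<open>f o\<^sub>L G = 0\<close>.\<close>
  case True
  then have "f \<otimes>\<^sub>L y = 0" by (intro blinfun_eqI) (simp add: rank_one_op.rep_eq)
  with True show ?thesis by simp
next
  case False
  with assms have "rank_one (f \<otimes>\<^sub>L y)" by (intro rank_one_rank_one_op) auto
  with assms show ?thesis by (simp add: daugavet_center_def norm_rank_one_op)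
qed

lemma daugavet_center_norm_compose:
  fixes G :: "'e::banach \<Rightarrow>\<^sub>L 'x::banach"
  assumes G: "daugavet_center G" and y: "norm y = 1"
    and less: "norm (id_blinfun + f \<otimes>\<^sub>L y) < 2 - \<epsilon>"
  shows "norm (f o\<^sub>L G) \<le> (1 - \<epsilon>) * norm G"
proof -
  have "G + (f o\<^sub>L G) \<otimes>\<^sub>L y = (id_blinfun + f \<otimes>\<^sub>L y) o\<^sub>L G"
    by (intro blinfun_eqI) (simp add: rank_one_op.rep_eq blinfun.add_left)
  then have "norm G + norm (f o\<^sub>L G) = norm ((id_blinfun + f \<otimes>\<^sub>L y) o\<^sub>L G)"
    using daugavet_center_norm_add[OF G y, of "f o\<^sub>L G"] by simp
  also have "\<dots> \<le> norm (id_blinfun + f \<otimes>\<^sub>L y) * norm G" by (rule norm_blinfun_compose)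
  also have "\<dots> \<le> (2 - \<epsilon>) * norm G" using less by (intro mult_right_mono) auto
  finally show ?thesis by (simp add: algebra_simps)
qed

lemma daugavet_center_slice_functional:
  fixes G :: "'e::banach \<Rightarrow>\<^sub>L 'x::banach"
  assumes G: "daugavet_center G" and z: "norm z = 1" and \<eta>: "0 < \<eta>" "\<eta> < 1"
  obtains f :: "'x \<Rightarrow>\<^sub>L real" where "norm f = 1" "f z > 1 - \<eta>" "norm (f o\<^sub>L G) > (1 - \<eta>) * norm G"
proof -
  define N where "N = norm G"
  have N: "N > 0" using G by (simp add: N_def daugavet_center_def)
  \<comment> \<open>A functional of norm one on \<open>'e\<close> requires a nonzero vector there,
    which \<open>G \<noteq> 0\<close> provides.\<close>
  obtain v where "G v \<noteq> 0" using N blinfun_eqI[of G 0] by (auto simp: N_def)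
  then have "v \<noteq> 0" by auto
  then obtain g0 :: "'e \<Rightarrow>\<^sub>L real" where g0: "norm g0 = 1" by (rule norming_functional)
  define g where "g = N *\<^sub>R g0"
  have g: "norm g = N" using g0 N by (simp add: g_def)
  have "norm (G + g \<otimes>\<^sub>L z) = 2 * N"
    using daugavet_center_norm_add[OF G z, of g] g by (simp add: N_def)
  moreover have "(2 - \<eta>) * N < 2 * N" using N \<eta> by simp
  ultimately have "\<not> norm (G + g \<otimes>\<^sub>L z) \<le> (2 - \<eta>) * N" by simp
  moreover have "0 \<le> (2 - \<eta>) * N" using N \<eta> by simp
  \<comment> \<open>The norm need not be attained, so \<open>e\<close> only almost attains it; it is
    not normalized, whence the factors \<open>norm e\<close> below.\<close>
  ultimately obtain e where e: "(2 - \<eta>) * N * norm e < norm ((G + g \<otimes>\<^sub>L z) e)"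
    using norm_blinfun_bound[of "(2 - \<eta>) * N" "G + g \<otimes>\<^sub>L z"] not_le by blast
  have e0: "norm e > 0" using e by (cases "e = 0") auto
  have Pe: "(G + g \<otimes>\<^sub>L z) e = G e + g e *\<^sub>R z" by (simp add: rank_one_op.rep_eq blinfun.add_left)
  have "(2 - \<eta>) * N * norm e \<ge> 0" using N \<eta> by simp
  then have "(G + g \<otimes>\<^sub>L z) e \<noteq> 0" using e by auto
  then obtain f :: "'x \<Rightarrow>\<^sub>L real" where f: "norm f = 1" "f ((G + g \<otimes>\<^sub>L z) e) = norm ((G + g \<otimes>\<^sub>L z) e)"
    by (rule norming_functional)
  \<comment> \<open>Both summands are at most \<open>N * norm e\<close>, so each must exceed
    \<open>(1 - \<eta>) * (N * norm e)\<close>. The second then gives the slice condition up to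
    sign, the first the bound on \<open>norm (f o\<^sub>L G)\<close>.\<close>
  have sum: "(2 - \<eta>) * (N * norm e) < f (G e) + g e * f z"
    using e f(2) by (simp add: Pe blinfun.add_right blinfun.scaleR_right mult_ac)
  have ge: "\<bar>g e\<bar> \<le> N * norm e" using norm_blinfun[of g e] g by simp
  have fz: "\<bar>f z\<bar> \<le> 1" using norm_blinfun[of f z] f z by simp
  have fG: "\<bar>f (G e)\<bar> \<le> norm (f o\<^sub>L G) * norm e" using norm_blinfun[of "f o\<^sub>L G" e] by simp
  have "norm (f o\<^sub>L G) \<le> N" using norm_blinfun_compose[of f G] f by (simp add: N_def)
  then have fG': "\<bar>f (G e)\<bar> \<le> N * norm e"
    using fG mult_right_mono[of "norm (f o\<^sub>L G)" N "norm e"] by simp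
  have gf: "g e * f z \<le> (N * norm e) * \<bar>f z\<bar>"
    using mult_right_mono[OF ge abs_ge_zero[of "f z"]] abs_ge_self[of "g e * f z"]
    by (simp add: abs_mult)
  have pos: "N * norm e > 0" using N e0 by simp
  have "(1 - \<eta>) * (N * norm e) < (N * norm e) * \<bar>f z\<bar>"
    using sum fG' gf by (simp add: algebra_simps)
  then have slice: "1 - \<eta> < \<bar>f z\<bar>" using pos by (metis mult.commute mult_less_cancel_left_pos)
  have "(N * norm e) * \<bar>f z\<bar> \<le> N * norm e" using mult_left_mono[OF fz, of "N * norm e"] pos by simp
  then have "(1 - \<eta>) * N * norm e < norm (f o\<^sub>L G) * norm e"
    using sum gf fG by (simp add: algebra_simps)
  then have big: "(1 - \<eta>) * norm G < norm (f o\<^sub>L G)" using e0 by (simp add: N_def)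
  show ?thesis
  proof (cases "f z \<ge> 0")
    case True
    then show ?thesis using that[of f] f(1) slice big by simp
  next
    case False
    have "(- f) o\<^sub>L G = - (f o\<^sub>L G)" by (intro blinfun_eqI) (simp add: blinfun.minus_left)
    then show ?thesis
      using that[of "- f"] False f(1) slice big by (simp add: blinfun.minus_left)
  qed
qed

theorem lemma2p6:
  assumes "\<exists>\<delta>>0. \<exists>z\<in>sphere (0::'x::banach) 1.
             star_denies_daugavet (dual_ball_slice z \<delta> \<inter> sphere 0 1)"
  shows "\<not> daugavet_range_from TYPE('e::banach) TYPE('x)"
proof
  assume "daugavet_range_from TYPE('e) TYPE('x)"
  then obtain G :: "'e \<Rightarrow>\<^sub>L 'x" where G: "daugavet_center G"
    by (auto simp: daugavet_range_from_def)
  obtain \<delta> \<epsilon> and z :: 'x where \<delta>: "\<delta> > 0" and z: "norm z = 1" and \<epsilon>: "\<epsilon> > 0"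
    and deny: "\<And>f. f \<in> dual_ball_slice z \<delta> \<Longrightarrow> norm f = 1 \<Longrightarrow>
      \<exists>y. norm y = 1 \<and> norm (id_blinfun + f \<otimes>\<^sub>L y) < 2 - \<epsilon>"
    using assms by (fastforce simp: star_denies_daugavet_def)
  \<comment> \<open>The bound \<delta> puts \<open>f\<close> into the given slice, \<epsilon> makes
    the two estimates of \<open>norm (f o\<^sub>L G)\<close> contradictory, and \<open>1 / 2\<close>
    keeps \<eta> below 1.\<close>
  define \<eta> where "\<eta> = min (1 / 2) (min \<delta> \<epsilon>)"
  have \<eta>: "0 < \<eta>" "\<eta> < 1" "\<eta> \<le> \<delta>" "\<eta> \<le> \<epsilon>" using \<delta> \<epsilon> by (auto simp: \<eta>_def)
  obtain f :: "'x \<Rightarrow>\<^sub>L real" where f: "norm f = 1" "f z > 1 - \<eta>" "norm (f o\<^sub>L G) > (1 - \<eta>) * norm G"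
    using daugavet_center_slice_functional[OF G z \<eta>(1,2)] .
  have "f \<in> dual_ball_slice z \<delta>" using f \<eta> by (simp add: dual_ball_slice_def)
  then obtain y where "norm y = 1" "norm (id_blinfun + f \<otimes>\<^sub>L y) < 2 - \<epsilon>"
    using deny f(1) by blast
  then have "norm (f o\<^sub>L G) \<le> (1 - \<epsilon>) * norm G" by (rule daugavet_center_norm_compose[OF G])
  moreover have "(1 - \<epsilon>) * norm G \<le> (1 - \<eta>) * norm G" using \<eta> by (intro mult_right_mono) auto
  ultimately show False using f(3) by simp
qed

end
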